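(* Let $G=(V,E)$ be a 2-sp-graph with $|E|=n$ and $|V|=k+1$. Then for every positive edge weighting $W=\operatorname{diag}(w_e)_{e\in E}$ (all $w_e>0$), $$\alpha_G(W)=\max_{\substack{I\subseteq E\\ |I|=k}}\lambda_{\min}P_I(W)\ \ge\ \frac1n .$$
   Context: Graphs are finite multigraphs. A 2-cycle is a pair of parallel edges joining two distinct vertices. A 2-sp-graph (2-connected series–parallel graph) is a graph obtained from a 2-cycle by a finite sequence of series extensions (subdivisions of edges) and parallel extensions (duplications of edges). Choose arbitrary directions of the edges and let $B\in\mathbb{R}^{(k+1)\times n}$ be the incidence matrix (rows indexed by vertices, columns by edges, the column of $e$ having entries $\pm1$ of opposite sign at the two ends of $e$, zeros elsewhere). Then $P(W)=W^{1/2}B^T(BWB^T)^+BW^{1/2}$ is the orthogonal projection onto $\operatorname{col}(W^{1/2}B^T)\subset\mathbb{R}^n$ ($^+$ is the Moore–Penrose inverse). $P_I(W)$ is the principal $k\times k$ submatrix of $P(W)$ with rows and columns indexed by $I$, and $\lambda_{\min}$ is the smallest eigenvalue. *)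

theory Defs
  imports "Jordan_Normal_Form.Char_Poly" "Jordan_Normal_Form.DL_Submatrix"
begin

record ('v, 'e) multigraph =
  vertices :: "'v set"
  edges :: "'e set"
  ends :: "'e \<Rightarrow> 'v set"

(* The label e is reused in the extensions: after a parallel extension e and f are the two
   copies of e; after a series extension e and f are the two halves of e, and x is the
   subdividing vertex.  Labels are otherwise arbitrary, so that the class of 2-sp-graphs is
   closed under renaming of vertices and edges.  The values of ends outside edges are
   irrelevant. *)
inductive two_sp_graph :: "('v, 'e) multigraph \<Rightarrow> bool" where
  two_cycle:
    "u \<noteq> v \<Longrightarrow> e \<noteq> f \<Longrightarrow> en e = {u, v} \<Longrightarrow> en f = {u, v} \<Longrightarrow>
     two_sp_graph \<lparr>vertices = {u, v}, edges = {e, f}, ends = en\<rparr>"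
| parallel:
    "two_sp_graph G \<Longrightarrow> e \<in> edges G \<Longrightarrow> f \<notin> edges G \<Longrightarrow>
     two_sp_graph \<lparr>vertices = vertices G, edges = insert f (edges G),
                    ends = (ends G)(f := ends G e)\<rparr>"
| series:
    "two_sp_graph G \<Longrightarrow> e \<in> edges G \<Longrightarrow> ends G e = {u, v} \<Longrightarrow>
     f \<notin> edges G \<Longrightarrow> x \<notin> vertices G \<Longrightarrow>
     two_sp_graph \<lparr>vertices = insert x (vertices G), edges = insert f (edges G),
                    ends = (ends G)(e := {u, x}, f := {x, v})\<rparr>"

lemma two_sp_graph_wf:
  assumes "two_sp_graph G"
  shows "finite (vertices G)" "finite (edges G)"
    and "\<And>e. e \<in> edges G \<Longrightarrow> ends G e \<subseteq> vertices G \<and> card (ends G e) = 2"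
proof -
  have "finite (vertices G) \<and> finite (edges G) \<and>
    (\<forall>e\<in>edges G. ends G e \<subseteq> vertices G \<and> card (ends G e) = 2)"
    using assms
  proof induction
    case (series G e u v f x)
    then have "u \<in> vertices G" "v \<in> vertices G" by auto
    with series have "x \<noteq> u" "x \<noteq> v" by auto
    with series show ?case by (auto simp: card_insert_if)
  qed auto
  then show "finite (vertices G)" "finite (edges G)"
    "\<And>e. e \<in> edges G \<Longrightarrow> ends G e \<subseteq> vertices G \<and> card (ends G e) = 2" by auto
qed

definition orientation :: "('v, 'e) multigraph \<Rightarrow> ('e \<Rightarrow> 'v) \<Rightarrow> ('e \<Rightarrow> 'v) \<Rightarrow> bool" where
  "orientation G src tgt \<longleftrightarrow> (\<forall>e\<in>edges G. ends G e = {src e, tgt e})"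

(* vs and es enumerate the vertices and the edges. *)
definition incidence_mat :: "'v list \<Rightarrow> 'e list \<Rightarrow> ('e \<Rightarrow> 'v) \<Rightarrow> ('e \<Rightarrow> 'v) \<Rightarrow> real mat" where
  "incidence_mat vs es src tgt = mat (length vs) (length es)
     (\<lambda>(i, j). if vs ! i = tgt (es ! j) then 1
               else if vs ! i = src (es ! j) then - 1 else 0)"

definition is_pinv :: "real mat \<Rightarrow> real mat \<Rightarrow> bool" where
  "is_pinv A X \<longleftrightarrow> X \<in> carrier_mat (dim_col A) (dim_row A) \<and>
     A * X * A = A \<and> X * A * X = X \<and> (A * X)\<^sup>T = A * X \<and> (X * A)\<^sup>T = X * A"

definition pinv :: "real mat \<Rightarrow> real mat" where
  "pinv A = (THE X. is_pinv A X)"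

lemma is_pinv_unique:
  assumes X: "is_pinv A X" and Y: "is_pinv A Y"
  shows "X = Y"
proof -
  let ?m = "dim_row A" and ?n = "dim_col A"
  have A [simp]: "A \<in> carrier_mat ?m ?n" by simp
  have cX [simp]: "X \<in> carrier_mat ?n ?m" and cY [simp]: "Y \<in> carrier_mat ?n ?m"
    using X Y by (auto simp: is_pinv_def)
  have eqs: "A * X * A = A" "X * A * X = X" "(A * X)\<^sup>T = A * X" "(X * A)\<^sup>T = X * A"
     "A * Y * A = A" "Y * A * Y = Y" "(A * Y)\<^sup>T = A * Y" "(Y * A)\<^sup>T = Y * A"
    using X Y by (auto simp: is_pinv_def)
  have cs [simp]: "A * X \<in> carrier_mat ?m ?m" "A * Y \<in> carrier_mat ?m ?m"
     "X * A \<in> carrier_mat ?n ?n" "Y * A \<in> carrier_mat ?n ?n"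
    by (auto intro: mult_carrier_mat[OF A cX] mult_carrier_mat[OF A cY]
        mult_carrier_mat[OF cX A] mult_carrier_mat[OF cY A])
  have "A * X = (A * Y * A) * X" by (simp only: eqs)
  also have "\<dots> = (A * Y) * (A * X)" by (rule assoc_mult_mat[OF cs(2) A cX])
  finally have "(A * X)\<^sup>T = (A * X)\<^sup>T * (A * Y)\<^sup>T"
    by (metis transpose_mult[OF cs(2) cs(1)])
  also have "\<dots> = (A * X) * (A * Y)" by (simp only: eqs)
  also have "\<dots> = A * X * A * Y" by (rule assoc_mult_mat[OF cs(1) A cY, symmetric])
  finally have 1: "A * X = A * Y" by (simp only: eqs)
  have "X * A = X * (A * Y * A)" by (simp only: eqs)
  also have "\<dots> = X * (A * (Y * A))" by (subst assoc_mult_mat[OF A cY A]) simp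
  also have "\<dots> = (X * A) * (Y * A)" by (rule assoc_mult_mat[OF cX A cs(4), symmetric])
  finally have "(X * A)\<^sup>T = (Y * A)\<^sup>T * (X * A)\<^sup>T"
    by (metis transpose_mult[OF cs(3) cs(4)])
  also have "\<dots> = (Y * A) * (X * A)" by (simp only: eqs)
  also have "\<dots> = Y * (A * (X * A))" by (rule assoc_mult_mat[OF cY A cs(3)])
  also have "\<dots> = Y * (A * X * A)" by (subst assoc_mult_mat[OF A cX A]) simp
  finally have 2: "X * A = Y * A" by (simp only: eqs)
  have "X = X * A * X" by (simp only: eqs)
  also have "\<dots> = Y * (A * X)" unfolding 2 by (rule assoc_mult_mat[OF cY A cX])
  also have "\<dots> = Y * A * Y" unfolding 1 by (rule assoc_mult_mat[OF cY A cY, symmetric])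
  finally show ?thesis by (simp only: eqs)
qed

definition weight_mat :: "'e list \<Rightarrow> ('e \<Rightarrow> real) \<Rightarrow> real mat" where
  "weight_mat es w = mat_diag (length es) (\<lambda>i. w (es ! i))"

definition proj_mat ::
  "'v list \<Rightarrow> 'e list \<Rightarrow> ('e \<Rightarrow> 'v) \<Rightarrow> ('e \<Rightarrow> 'v) \<Rightarrow> ('e \<Rightarrow> real) \<Rightarrow> real mat" where
  "proj_mat vs es src tgt w =
     (let B = incidence_mat vs es src tgt;
          W = weight_mat es w;
          R = weight_mat es (\<lambda>e. sqrt (w e))
      in R * B\<^sup>T * pinv (B * W * B\<^sup>T) * B * R)"

definition principal_submat :: "'e list \<Rightarrow> real mat \<Rightarrow> 'e set \<Rightarrow> real mat" where
  "principal_submat es A I =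
     (let J = {i. i < length es \<and> es ! i \<in> I} in submatrix A J J)"

(* Meaningful for nonempty symmetric matrices: these have a real eigenvalue, and all their
   complex eigenvalues are real. *)
definition lambda_min :: "real mat \<Rightarrow> real" where
  "lambda_min A = Min {x. eigenvalue A x}"

end

theory Submission
  imports Defs "Jordan_Normal_Form.Spectral_Radius"
begin

text \<open>
  The vectors in the column space of \<open>R B\<^sup>T\<close>, \<open>R = \<surd>W\<close>, are the weighted potential differences
  \<open>\<surd>w\<^sub>e (\<phi> (tgt e) - \<phi> (src e))\<close>. Hence the smallest eigenvalue of \<open>P\<^sub>T\<close> is at least \<open>1 / n\<close> as soon as
  \<^item> the energy of every potential \<open>\<phi>\<close> on all edges is at most \<open>n\<close> times its energy on \<open>T\<close>, and
  \<^item> \<open>P\<^sub>T\<close> is nonsingular, which holds if every edge of \<open>T\<close> has a potential that drops along this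
    edge and along no other edge of \<open>T\<close> (a fundamental cut of the tree \<open>T\<close>).

  Indeed, if \<open>P\<^sub>T x = \<mu> x\<close> and \<open>z\<close> is \<open>x\<close> extended by zeros, then \<open>y = P z\<close> has
  \<open>\<mu> |x|\<^sup>2 = |y|\<^sup>2 \<le> n |y\<^sub>T|\<^sup>2 = n \<mu>\<^sup>2 |x|\<^sup>2\<close> (lemma \<open>eigenvalue_principal_submatrix_ge\<close>).

  The matter is thus to find a spanning tree \<open>T\<close> with the first property. It does not reproduce itself
  under series and parallel extensions, so it is embedded in a family of statements that does
  (lemma \<open>certificate_exists\<close>). An edge \<open>e\<close> now stands for a two-terminal series-parallel network
  with \<open>m\<^sub>e\<close> edges. With \<open>N\<close> the total number of edges, the quadratic form
  \<open>N \<cdot> (energy on T) - (energy)\<close>, minimised over the potentials inside that network, becomes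
  \<open>a\<^sub>e\<close> times the squared drop if \<open>T\<close> connects the terminals inside the network, and \<open>- b\<^sub>e\<close> times it
  if not. The invariant is \<open>N b\<^sub>e \<le> m\<^sub>e (a\<^sub>e + b\<^sub>e)\<close>. For a single edge, \<open>a = (N - 1) w\<close> and
  \<open>b = w\<close> satisfy it with equality.

  Two parallel networks have \<open>b = b\<^sub>1 + b\<^sub>2\<close> and, with the better one of the two possible trees,
  \<open>a = max (a\<^sub>1 - b\<^sub>2) (a\<^sub>2 - b\<^sub>1)\<close>; so \<open>a + b\<close> is the maximum of the \<open>a\<^sub>i + b\<^sub>i\<close>, and the invariant
  survives because a mediant is at most the larger of the two fractions. In terms of reciprocals the
  invariant reads \<open>N / a \<le> m (1 / a + 1 / b)\<close>, and two networks in series obey the same rules as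
  parallel ones with \<open>b\<close> replaced by \<open>1 / a\<close> and \<open>a\<close> by \<open>1 / b\<close>. Finally, in a 2-cycle with
  \<open>m\<^sub>1 + m\<^sub>2 = N\<close> the invariants force \<open>max (a\<^sub>1 - b\<^sub>2) (a\<^sub>2 - b\<^sub>1) \<ge> 0\<close>, which is the claim there.
\<close>

section \<open>Potential drops and the inductive certificate\<close>

text \<open>
  The squared potential difference along an edge, as a function of the unordered pair of its ends.
\<close>
definition drop2 :: "('v \<Rightarrow> real) \<Rightarrow> 'v set \<Rightarrow> real" where
  "drop2 \<phi> S = (Max (\<phi> ` S) - Min (\<phi> ` S))\<^sup>2"

lemma drop2_pair [simp]: "drop2 \<phi> {u, v} = (\<phi> u - \<phi> v)\<^sup>2"
  by (simp add: drop2_def max_def min_def power2_commute)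

lemma drop2_upd: "x \<notin> S \<Longrightarrow> drop2 (\<phi>(x := c)) S = drop2 \<phi> S"
  unfolding drop2_def by (auto intro!: arg_cong2[where f = "\<lambda>A B. (Max A - Min B)\<^sup>2"])

text \<open>
  The third condition gives a fundamental cut for every edge of \<open>T\<close>, which makes \<open>T\<close> acyclic, hence
  a spanning tree by its cardinality. In this form no orientation has to be carried through the
  induction.
\<close>
definition certificate ::
  "('v, 'e) multigraph \<Rightarrow> ('e \<Rightarrow> real) \<Rightarrow> ('e \<Rightarrow> real) \<Rightarrow> 'e set \<Rightarrow> bool" where
  "certificate G a b T \<longleftrightarrow> T \<subseteq> edges G \<and> card T + 1 = card (vertices G) \<and>
     (\<forall>e\<in>T. \<exists>\<phi>. drop2 \<phi> (ends G e) \<noteq> 0 \<and> (\<forall>f\<in>T - {e}. drop2 \<phi> (ends G f) = 0)) \<and>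
     (\<forall>\<phi>. 0 \<le> (\<Sum>e\<in>edges G. (if e \<in> T then a e else - b e) * drop2 \<phi> (ends G e)))"

section \<open>Merging two networks\<close>

text \<open>
  The mediant \<open>(x1 + x2) / (m1 + m2)\<close> is at most the larger \<open>x\<^sub>i / m\<^sub>i\<close>, and \<open>N\<close> times each of these is at
  most \<open>s\<^sub>i\<close>. It serves with \<open>x = b\<close> for parallel and with \<open>x = 1 / a\<close> for series networks.
\<close>
lemma mediant_max:
  fixes N :: real
  assumes "m1 > 0" "m2 > 0" "N * x1 \<le> m1 * s1" "N * x2 \<le> m2 * s2"
  shows "N * (x1 + x2) \<le> (m1 + m2) * max s1 s2"
proof -
  have "m1 * s1 \<le> m1 * max s1 s2" "m2 * s2 \<le> m2 * max s1 s2"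
    using assms by (auto intro!: mult_left_mono)
  with assms have "N * x1 + N * x2 \<le> m1 * max s1 s2 + m2 * max s1 s2" by linarith
  then show ?thesis by (simp add: distrib_left distrib_right)
qed

text \<open>
  The difference of the two sides is \<open>(a p - b q)\<^sup>2 / (a + b)\<close>: a fixed total drop dissipates least
  when the current is the same in both resistors.
\<close>
lemma series_conductance:
  fixes a b c p q :: real
  assumes "a > 0" "b > 0" "1 / c = 1 / a + 1 / b"
  shows "c * (p + q)\<^sup>2 \<le> a * p\<^sup>2 + b * q\<^sup>2"
proof -
  have "1 / c = (a + b) / (a * b)" using assms by (simp add: field_simps)
  then have c: "c = a * b / (a + b)" by (metis inverse_divide inverse_eq_divide inverse_inverse_eq)
  have "(a * p\<^sup>2 + b * q\<^sup>2) * (a + b) - a * b * (p + q)\<^sup>2 = (a * p - b * q)\<^sup>2"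
    by (simp add: power2_eq_square algebra_simps)
  then have "a * b * (p + q)\<^sup>2 \<le> (a * p\<^sup>2 + b * q\<^sup>2) * (a + b)"
    by (smt (verit) zero_le_power2)
  then show ?thesis using assms by (simp add: c field_simps)
qed

lemma parallel_merge:
  fixes N :: real
  assumes "m1 > 0" "m2 > 0" "N * b1 \<le> m1 * (a1 + b1)" "N * b2 \<le> m2 * (a2 + b2)"
  shows "N * (b1 + b2) \<le> (m1 + m2) * (max (a1 - b2) (a2 - b1) + (b1 + b2))"
proof -
  have "max (a1 - b2) (a2 - b1) + (b1 + b2) = max (a1 + b1) (a2 + b2)" by (simp add: max_def)
  then show ?thesis using mediant_max[OF assms] by simp
qed

text \<open>
  The strict inequality \<open>m1 + m2 < N\<close> keeps all values positive, so that reciprocals make sense: without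
  it the quadratic form could be unbounded below in the potential of the inner vertex. The third
  conclusion covers a tree that connects the terminals. The disjunction says which of the two edges
  to put into a tree that does not: the first disjunct selects the first edge.
\<close>
lemma series_merge:
  fixes N :: real
  assumes m: "m1 > 0" "m2 > 0" "m1 + m2 < N" and b: "b1 > 0" "b2 > 0"
    and h: "N * b1 \<le> m1 * (a1 + b1)" "N * b2 \<le> m2 * (a2 + b2)"
  obtains a b where "b > 0" "N * b \<le> (m1 + m2) * (a + b)"
    "\<And>p q. a * (p + q)\<^sup>2 \<le> a1 * p\<^sup>2 + a2 * q\<^sup>2"
    "(\<forall>p q. b2 * q\<^sup>2 \<le> a1 * p\<^sup>2 + b * (p + q)\<^sup>2) \<or> (\<forall>p q. b1 * p\<^sup>2 \<le> a2 * q\<^sup>2 + b * (p + q)\<^sup>2)"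
proof -
  have pos: "\<alpha> > 0" if "N * \<beta> \<le> \<mu> * (\<alpha> + \<beta>)" "\<beta> > 0" "\<mu> > 0" "\<mu> < N" for \<alpha> \<beta> \<mu> :: real
  proof -
    have "\<mu> * \<beta> < N * \<beta>" using that by simp
    then have "\<mu> * \<alpha> > 0" using that(1) by (simp add: distrib_left)
    then show ?thesis using that by (simp add: zero_less_mult_iff)
  qed
  have a: "a1 > 0" "a2 > 0" using pos[OF h(1)] pos[OF h(2)] m b by auto
  have rec: "N * (1 / \<alpha>) \<le> \<mu> * (1 / \<alpha> + 1 / \<beta>)"
    if "N * \<beta> \<le> \<mu> * (\<alpha> + \<beta>)" "\<alpha> > 0" "\<beta> > 0" for \<alpha> \<beta> \<mu> :: real
    using that by (simp add: field_simps)
  define A where "A = 1 / a1 + 1 / a2"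
  define S where "S = max (1 / a1 + 1 / b1) (1 / a2 + 1 / b2)"
  have A: "A > 0" using a by (simp add: A_def add_pos_pos)
  have le: "N * A \<le> (m1 + m2) * S"
    unfolding A_def S_def using mediant_max[OF m(1,2)] rec[OF h(1)] rec[OF h(2)] a b by blast
  have "(m1 + m2) * A < N * A" using m A by simp
  with le have "(m1 + m2) * A < (m1 + m2) * S" by linarith
  then have B: "S - A > 0" using m by simp
  show thesis
  proof (rule that[where b = "1 / (S - A)" and a = "1 / A"])
    show "0 < 1 / (S - A)" using B by simp
    have "N * (1 / (S - A)) = N * A / (A * (S - A))" using A by simp
    also have "\<dots> \<le> (m1 + m2) * S / (A * (S - A))"
      using le A B by (intro divide_right_mono) simp_all
    also have "\<dots> = (m1 + m2) * (1 / A + 1 / (S - A))" using A B by (simp add: field_simps)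
    finally show "N * (1 / (S - A)) \<le> (m1 + m2) * (1 / A + 1 / (S - A))" .
    show "1 / A * (p + q)\<^sup>2 \<le> a1 * p\<^sup>2 + a2 * q\<^sup>2" for p q
      by (rule series_conductance) (use a in \<open>simp_all add: A_def\<close>)
    \<comment> \<open>A form with a negative coefficient is handled by moving it to the other side: \<open>b2\<close> is the series
      conductance of \<open>a1\<close> and \<open>1 / (S - A)\<close>, for the drops \<open>- p\<close> and \<open>p + q\<close> with sum \<open>q\<close>.\<close>
    consider "S = 1 / a2 + 1 / b2" | "S = 1 / a1 + 1 / b1" unfolding S_def by linarith
    then show "(\<forall>p q. b2 * q\<^sup>2 \<le> a1 * p\<^sup>2 + 1 / (S - A) * (p + q)\<^sup>2) \<or>
      (\<forall>p q. b1 * p\<^sup>2 \<le> a2 * q\<^sup>2 + 1 / (S - A) * (p + q)\<^sup>2)"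
    proof cases
      case 1
      have "b2 * ((- p) + (p + q))\<^sup>2 \<le> a1 * (- p)\<^sup>2 + 1 / (S - A) * (p + q)\<^sup>2" for p q
        by (rule series_conductance) (use a b B 1 in \<open>simp_all add: A_def\<close>)
      then show ?thesis by simp
    next
      case 2
      have "b1 * ((- q) + (p + q))\<^sup>2 \<le> a2 * (- q)\<^sup>2 + 1 / (S - A) * (p + q)\<^sup>2" for p q
        by (rule series_conductance) (use a b B 2 in \<open>simp_all add: A_def\<close>)
      then show ?thesis by simp
    qed
  qed
qed

section \<open>Induction over series and parallel extensions\<close>

lemma two_sp_graph_two_edges:
  assumes "two_sp_graph G"
  shows "card (edges G) \<ge> 2"
  using assms by induction (auto simp: card_insert_if two_sp_graph_wf)

lemma sum_insert_split:
  fixes h :: "'e \<Rightarrow> real"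
  assumes "finite E" "e \<in> E" "f \<notin> E"
  shows "sum h (insert f E) = h e + h f + sum h (E - {e})"
  using assms by (simp add: sum.remove[of E e h])

text \<open>
  Each extension is undone by merging \<open>e\<close> and \<open>f\<close> into one edge with the merged parameters; the tree
  that the induction hypothesis provides for the smaller graph is then lifted. The sum of \<open>m\<close>, which
  plays the part of \<open>N\<close>, does not change under merging.
\<close>
lemma certificate_exists:
  assumes "two_sp_graph G"
    and "\<And>e. e \<in> edges G \<Longrightarrow> m e > 0 \<and> b e > 0 \<and> sum m (edges G) * b e \<le> m e * (a e + b e)"
  shows "\<exists>T. certificate G a b T"
  using assms
proof (induction arbitrary: m a b)
  case (two_cycle u v e f en)
  let ?G = "\<lparr>vertices = {u, v}, edges = {e, f}, ends = en\<rparr>"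
  have "sum m {e, f} = m e + m f" using two_cycle by simp
  then have "(m e + m f) * (b e + b f) \<le> (m e + m f) * max (a e + b e) (a f + b f)"
    using two_cycle.prems[of e] two_cycle.prems[of f] by (intro mediant_max) simp_all
  moreover have "m e + m f > 0" using two_cycle.prems[of e] two_cycle.prems[of f] by simp
  ultimately have "b e + b f \<le> max (a e + b e) (a f + b f)" by simp
  then consider "b f \<le> a e" | "b e \<le> a f" by linarith
  then show ?case
  proof cases
    case 1
    have "certificate ?G a b {e}"
      using two_cycle 1 
      by (auto simp: certificate_def intro!: exI[where x="\<lambda>y. if y = u then 1 else 0"] mult_right_mono)
    then show ?thesis ..
  next
    case 2
    have "certificate ?G a b {f}"
      using two_cycle 2 
      by (auto simp: certificate_def intro!: exI[where x="\<lambda>y. if y = u then 1 else 0"] mult_right_mono)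
    then show ?thesis ..
  qed
next
  case (parallel G e f)
  note wf = two_sp_graph_wf[OF parallel.hyps(1)]
  have ef: "e \<noteq> f" using parallel.hyps by auto
  let ?E = "edges G"
  let ?G = "\<lparr>vertices = vertices G, edges = insert f ?E, ends = (ends G)(f := ends G e)\<rparr>"
  define m' where "m' = m(e := m e + m f)"
  define b' where "b' = b(e := b e + b f)"
  define a' where "a' = a(e := max (a e - b f) (a f - b e))"
  have prem: "m g > 0" "b g > 0" "sum m (insert f ?E) * b g \<le> m g * (a g + b g)"
    if "g \<in> insert f ?E" for g
    using parallel.prems[of g] that by auto
  have "sum m' ?E = m' e + sum m' (?E - {e})" using wf parallel.hyps by (simp add: sum.remove)
  also have "sum m' (?E - {e}) = sum m (?E - {e})" by (intro sum.cong) (auto simp: m'_def)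
  finally have N: "sum m' ?E = sum m (insert f ?E)"
    using sum_insert_split[OF wf(2) parallel.hyps(2,3), of m] by (simp add: m'_def)
  have "m' g > 0 \<and> b' g > 0 \<and> sum m' ?E * b' g \<le> m' g * (a' g + b' g)" if "g \<in> ?E" for g
  proof (cases "g = e")
    case True
    then show ?thesis unfolding N
      using prem[of e] prem[of f] parallel.hyps parallel_merge[of "m e" "m f" _ "b e" "a e" "b f" "a f"]
      by (simp add: m'_def b'_def a'_def)
  next
    case False
    then show ?thesis unfolding N using prem[of g] that by (simp add: m'_def b'_def a'_def)
  qed
  then obtain T where T: "certificate G a' b' T" using parallel.IH by blast
  then have TE: "T \<subseteq> ?E" and fT: "f \<notin> T" using parallel.hyps by (auto simp: certificate_def)
  have finT: "finite T" using TE wf finite_subset by blast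
  have form: "0 \<le> (\<Sum>g\<in>?E. (if g \<in> T then a' g else - b' g) * drop2 \<phi> (ends G g))" for \<phi>
    using T by (simp add: certificate_def)
  have form': "0 \<le> (if e \<in> T then a' e else - b' e) * drop2 \<phi> (ends G e)
      + (\<Sum>g\<in>?E - {e}. (if g \<in> T then a g else - b g) * drop2 \<phi> (ends G g))" for \<phi>
  proof -
    have "(\<Sum>g\<in>?E - {e}. (if g \<in> T then a' g else - b' g) * drop2 \<phi> (ends G g))
        = (\<Sum>g\<in>?E - {e}. (if g \<in> T then a g else - b g) * drop2 \<phi> (ends G g))"
      by (intro sum.cong) (auto simp: a'_def b'_def)
    then show ?thesis using form[of \<phi>] wf parallel.hyps by (simp add: sum.remove)
  qed
  have new: "(\<Sum>g\<in>edges ?G. (if g \<in> T' then a g else - b g) * drop2 \<phi> (ends ?G g))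
     = ((if e \<in> T' then a e else - b e) + (if f \<in> T' then a f else - b f)) * drop2 \<phi> (ends G e)
      + (\<Sum>g\<in>?E - {e}. (if g \<in> T then a g else - b g) * drop2 \<phi> (ends G g))"
    if "T' - {e, f} = T - {e, f}" for T' \<phi>
  proof -
    have "(\<Sum>g\<in>?E - {e}. (if g \<in> T' then a g else - b g) * drop2 \<phi> (ends ?G g))
      = (\<Sum>g\<in>?E - {e}. (if g \<in> T then a g else - b g) * drop2 \<phi> (ends G g))"
      using that parallel.hyps by (intro sum.cong) (auto split: if_splits)
    then show ?thesis
      using sum_insert_split[OF wf(2) parallel.hyps(2,3),
        of "\<lambda>g. (if g \<in> T' then a g else - b g) * drop2 \<phi> (ends ?G g)"] ef
      by (simp add: algebra_simps)
  qed
  show ?case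
  proof (cases "e \<in> T \<and> a e - b f < a f - b e")
    case False
    have "certificate ?G a b T"
      unfolding certificate_def
    proof (intro conjI allI ballI)
      fix g assume "g \<in> T"
      then obtain \<phi> where "drop2 \<phi> (ends G g) \<noteq> 0" "\<And>h. h \<in> T - {g} \<Longrightarrow> drop2 \<phi> (ends G h) = 0"
        using T unfolding certificate_def by blast
      moreover have "ends ?G h = ends G h" if "h \<in> T" for h using that fT by auto
      ultimately show "\<exists>\<phi>. drop2 \<phi> (ends ?G g) \<noteq> 0 \<and> (\<forall>h\<in>T - {g}. drop2 \<phi> (ends ?G h) = 0)"
        using \<open>g \<in> T\<close> by (metis Diff_iff)
    next
      fix \<phi>
      show "0 \<le> (\<Sum>g\<in>edges ?G. (if g \<in> T then a g else - b g) * drop2 \<phi> (ends ?G g))"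
        unfolding new[OF refl] using form'[of \<phi>] fT False
        by (auto simp: a'_def b'_def max_def split: if_splits)
    qed (use T fT in \<open>auto simp: certificate_def\<close>)
    then show ?thesis ..
  next
    case True
    \<comment> \<open>Exchange \<open>e\<close> for its copy; \<open>r\<close> below maps the edges of \<open>T'\<close> back to those of \<open>T\<close>.\<close>
    define T' where "T' = insert f (T - {e})"
    have "card T' = card T" using True fT finT
      by (metis T'_def card_Suc_Diff1 card_insert_disjoint finite_Diff Diff_iff)
    have "certificate ?G a b T'"
      unfolding certificate_def
    proof (intro conjI allI ballI)
      fix \<phi>
      have "T' - {e, f} = T - {e, f}" by (auto simp: T'_def)
      from new[OF this]
      show "0 \<le> (\<Sum>g\<in>edges ?G. (if g \<in> T' then a g else - b g) * drop2 \<phi> (ends ?G g))"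
        using form'[of \<phi>] fT True ef
        by (auto simp: a'_def b'_def max_def T'_def split: if_splits)
    next
      fix g assume g: "g \<in> T'"
      define r where "r h = (if h = f then e else h)" for h
      have r: "r h \<in> T" "ends ?G h = ends G (r h)" if "h \<in> T'" for h
        using that True by (auto simp: T'_def r_def)
      have inj: "r h \<noteq> r g" if "h \<in> T' - {g}" for h
        using that g by (auto simp: T'_def r_def)
      obtain \<phi> where \<phi>: "drop2 \<phi> (ends G (r g)) \<noteq> 0"
        "\<And>h. h \<in> T - {r g} \<Longrightarrow> drop2 \<phi> (ends G h) = 0"
        using T r(1)[OF g] unfolding certificate_def by blast
      have "drop2 \<phi> (ends ?G h) = 0" if "h \<in> T' - {g}" for h
        using \<phi>(2)[of "r h"] r[of h] inj[OF that] that by (metis DiffD1 DiffI singletonD)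
      moreover have "drop2 \<phi> (ends ?G g) \<noteq> 0" using \<phi>(1) r(2)[OF g] by metis
      ultimately show "\<exists>\<phi>. drop2 \<phi> (ends ?G g) \<noteq> 0 \<and> (\<forall>h\<in>T' - {g}. drop2 \<phi> (ends ?G h) = 0)"
        by blast
    qed (use T fT \<open>card T' = card T\<close> in \<open>auto simp: certificate_def T'_def\<close>)
    then show ?thesis ..
  qed
next
  case (series G e u v f x)
  note wf = two_sp_graph_wf[OF series.hyps(1)]
  have ef: "e \<noteq> f" using series.hyps by auto
  have uv: "u \<in> vertices G" "v \<in> vertices G" "u \<noteq> v"
    using wf(3)[OF series.hyps(2)] series.hyps(3) by (auto simp: card_2_iff)
  have xuv: "x \<noteq> u" "x \<noteq> v" using uv series.hyps by auto
  let ?E = "edges G"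
  let ?G = "\<lparr>vertices = insert x (vertices G), edges = insert f ?E,
              ends = (ends G)(e := {u, x}, f := {x, v})\<rparr>"
  have prem: "m g > 0" "b g > 0" "sum m (insert f ?E) * b g \<le> m g * (a g + b g)"
    if "g \<in> insert f ?E" for g
    using series.prems[of g] that by auto
  have N0: "sum m (insert f ?E) = m e + m f + sum m (?E - {e})"
    by (rule sum_insert_split[OF wf(2) series.hyps(2,4)])
  \<comment> \<open>A third edge makes the sum exceed \<open>m e + m f\<close> strictly.\<close>
  have "?E - {e} \<noteq> {}"
    using two_sp_graph_two_edges[OF series.hyps(1)] card_mono[of "{e}" ?E] by fastforce
  then have "sum m (?E - {e}) > 0" using wf prem by (intro sum_pos) auto
  then have less: "m e + m f < sum m (insert f ?E)" using N0 by simp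
  obtain ae be where ab: "be > 0" "sum m (insert f ?E) * be \<le> (m e + m f) * (ae + be)"
    "\<And>p q. ae * (p + q)\<^sup>2 \<le> a e * p\<^sup>2 + a f * q\<^sup>2"
    "(\<forall>p q. b f * q\<^sup>2 \<le> a e * p\<^sup>2 + be * (p + q)\<^sup>2) \<or>
     (\<forall>p q. b e * p\<^sup>2 \<le> a f * q\<^sup>2 + be * (p + q)\<^sup>2)"
    using series_merge[OF _ _ less, of "b e" "b f" "a e" "a f"] prem[of e] prem[of f] series.hyps
    by (metis insertCI)
  define m' where "m' = m(e := m e + m f)"
  define b' where "b' = b(e := be)"
  define a' where "a' = a(e := ae)"
  have "sum m' ?E = m' e + sum m' (?E - {e})" using wf series.hyps by (simp add: sum.remove)
  also have "sum m' (?E - {e}) = sum m (?E - {e})" by (intro sum.cong) (auto simp: m'_def)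
  finally have N: "sum m' ?E = sum m (insert f ?E)" by (simp add: N0 m'_def)
  have "m' g > 0 \<and> b' g > 0 \<and> sum m' ?E * b' g \<le> m' g * (a' g + b' g)" if "g \<in> ?E" for g
    unfolding N using prem[of g] prem[of e] prem[of f] ab series.hyps that
    by (auto simp: m'_def b'_def a'_def)
  then obtain T where T: "certificate G a' b' T" using series.IH by blast
  then have TE: "T \<subseteq> ?E" and fT: "f \<notin> T" using series.hyps by (auto simp: certificate_def)
  have finT: "finite T" using TE wf finite_subset by blast
  have form': "0 \<le> (if e \<in> T then ae else - be) * ((\<phi> u - \<phi> x) + (\<phi> x - \<phi> v))\<^sup>2
      + (\<Sum>g\<in>?E - {e}. (if g \<in> T then a g else - b g) * drop2 \<phi> (ends G g))" for \<phi>
  proof -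
    have "0 \<le> (\<Sum>g\<in>?E. (if g \<in> T then a' g else - b' g) * drop2 \<phi> (ends G g))"
      using T by (simp add: certificate_def)
    moreover have "(\<Sum>g\<in>?E - {e}. (if g \<in> T then a' g else - b' g) * drop2 \<phi> (ends G g))
        = (\<Sum>g\<in>?E - {e}. (if g \<in> T then a g else - b g) * drop2 \<phi> (ends G g))"
      by (intro sum.cong) (auto simp: a'_def b'_def)
    ultimately show ?thesis using wf series.hyps by (auto simp: sum.remove a'_def b'_def)
  qed
  have new: "(\<Sum>g\<in>edges ?G. (if g \<in> T' then a g else - b g) * drop2 \<phi> (ends ?G g))
     = (if e \<in> T' then a e else - b e) * (\<phi> u - \<phi> x)\<^sup>2 + (if f \<in> T' then a f else - b f) * (\<phi> x - \<phi> v)\<^sup>2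
      + (\<Sum>g\<in>?E - {e}. (if g \<in> T then a g else - b g) * drop2 \<phi> (ends G g))"
    if "T' - {e, f} = T - {e, f}" for T' \<phi>
  proof -
    have "(\<Sum>g\<in>?E - {e}. (if g \<in> T' then a g else - b g) * drop2 \<phi> (ends ?G g))
      = (\<Sum>g\<in>?E - {e}. (if g \<in> T then a g else - b g) * drop2 \<phi> (ends G g))"
      using that series.hyps by (intro sum.cong) (auto split: if_splits)
    then show ?thesis
      using sum_insert_split[OF wf(2) series.hyps(2,4),
        of "\<lambda>g. (if g \<in> T' then a g else - b g) * drop2 \<phi> (ends ?G g)"] ef
      by simp
  qed
  have old: "drop2 (\<phi>(x := c)) (ends ?G g) = drop2 \<phi> (ends G g)" if "g \<in> ?E - {e}" for \<phi> c g
  proof -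
    have "x \<notin> ends G g" using wf(3)[of g] series.hyps that by auto
    then show ?thesis using that series.hyps by (auto simp: drop2_upd)
  qed
  have cut: "\<exists>\<phi>. drop2 \<phi> (ends G g) \<noteq> 0 \<and> (\<forall>h\<in>T - {g}. drop2 \<phi> (ends G h) = 0)" if "g \<in> T" for g
    using T that unfolding certificate_def by blast
  have card: "card T + 1 = card (vertices G)" using T unfolding certificate_def by blast
  show ?case
  proof (cases "e \<in> T")
    case True
    have "certificate ?G a b (insert f T)"
      unfolding certificate_def
    proof (intro conjI allI ballI)
      fix \<phi>
      have "insert f T - {e, f} = T - {e, f}" by auto
      from new[OF this]
      show "0 \<le> (\<Sum>g\<in>edges ?G. (if g \<in> insert f T then a g else - b g) * drop2 \<phi> (ends ?G g))"
        using form'[of \<phi>] ab(3)[of "\<phi> u - \<phi> x" "\<phi> x - \<phi> v"] fT True ef by simp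
    next
      fix g assume "g \<in> insert f T"
      then consider "g = f" | "g = e" | "g \<noteq> e" "g \<noteq> f" "g \<in> T" by blast
      then show "\<exists>\<phi>. drop2 \<phi> (ends ?G g) \<noteq> 0 \<and> (\<forall>h\<in>insert f T - {g}. drop2 \<phi> (ends ?G h) = 0)"
      \<comment> \<open>A cut potential of the smaller graph extends to the new vertex: the value is that of \<open>u\<close> or
        \<open>v\<close>, so as to shift a drop between \<open>u\<close> and \<open>v\<close> entirely to one half of the subdivided edge.\<close>
      proof cases
        case 1
        obtain \<phi> where \<phi>: "drop2 \<phi> (ends G e) \<noteq> 0" "\<And>h. h \<in> T - {e} \<Longrightarrow> drop2 \<phi> (ends G h) = 0"
          using cut[OF True] by blast
        have "drop2 (\<phi>(x := \<phi> u)) (ends ?G h) = 0" if "h \<in> insert f T - {g}" for h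
          using that 1 \<phi>(2)[of h] old[of h] TE xuv ef by (cases "h = e") auto
        moreover have "drop2 (\<phi>(x := \<phi> u)) (ends ?G g) \<noteq> 0"
          using 1 \<phi>(1) xuv series.hyps by auto
        ultimately show ?thesis by blast
      next
        case 2
        obtain \<phi> where \<phi>: "drop2 \<phi> (ends G e) \<noteq> 0" "\<And>h. h \<in> T - {e} \<Longrightarrow> drop2 \<phi> (ends G h) = 0"
          using cut[OF True] by blast
        have "drop2 (\<phi>(x := \<phi> v)) (ends ?G h) = 0" if "h \<in> insert f T - {g}" for h
          using that 2 \<phi>(2)[of h] old[of h] TE xuv ef by (cases "h = f") auto
        moreover have "drop2 (\<phi>(x := \<phi> v)) (ends ?G g) \<noteq> 0"
          using 2 \<phi>(1) xuv series.hyps ef by auto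
        ultimately show ?thesis by blast
      next
        case 3
        obtain \<phi> where \<phi>: "drop2 \<phi> (ends G g) \<noteq> 0" "\<And>h. h \<in> T - {g} \<Longrightarrow> drop2 \<phi> (ends G h) = 0"
          using cut[OF 3(3)] by blast
        have "\<phi> u = \<phi> v" using \<phi>(2)[of e] 3 True series.hyps by simp
        then have "drop2 (\<phi>(x := \<phi> u)) (ends ?G h) = 0" if "h \<in> insert f T - {g}" for h
          using that 3 \<phi>(2)[of h] old[of h] TE xuv ef by (cases "h = e \<or> h = f") auto
        moreover have "drop2 (\<phi>(x := \<phi> u)) (ends ?G g) \<noteq> 0"
          using 3 \<phi>(1) old[of g] TE by auto
        ultimately show ?thesis by blast
      qed
    qed (use TE fT finT wf card series.hyps in \<open>auto simp: certificate_def\<close>)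
    then show ?thesis ..
  next
    case False
    \<comment> \<open>The new vertex is a leaf of the new tree, attached by one of the two halves \<open>g\<close>.\<close>
    have extend: "certificate ?G a b (insert g T)"
      if g: "g \<in> {e, f}" and le: "\<And>\<phi>. - be * ((\<phi> u - \<phi> x) + (\<phi> x - \<phi> v))\<^sup>2 \<le>
          (if g = e then a e else - b e) * (\<phi> u - \<phi> x)\<^sup>2 + (if g = f then a f else - b f) * (\<phi> x - \<phi> v)\<^sup>2"
      for g
      unfolding certificate_def
    proof (intro conjI allI ballI)
      fix \<phi>
      have "insert g T - {e, f} = T - {e, f}" using g by auto
      from new[OF this]
      show "0 \<le> (\<Sum>h\<in>edges ?G. (if h \<in> insert g T then a h else - b h) * drop2 \<phi> (ends ?G h))"
        using form'[of \<phi>] le[of \<phi>] fT False ef g by (auto split: if_splits)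
    next
      fix h assume "h \<in> insert g T"
      then consider "h = g" | "h \<noteq> g" "h \<in> T" by blast
      then show "\<exists>\<phi>. drop2 \<phi> (ends ?G h) \<noteq> 0 \<and> (\<forall>h'\<in>insert g T - {h}. drop2 \<phi> (ends ?G h') = 0)"
      proof cases
        case 1
        have zero: "drop2 (\<lambda>_. 0) (ends G h') = 0" if "h' \<in> ?E" for h'
          using wf(3)[OF that] by (auto simp: card_2_iff)
        have "drop2 ((\<lambda>_. 0)(x := 1)) (ends ?G h') = 0" if "h' \<in> insert g T - {h}" for h'
        proof -
          have h': "h' \<in> ?E - {e}" using that 1 TE False by auto
          show ?thesis unfolding old[OF h'] using zero h' by blast
        qed
        moreover have "drop2 ((\<lambda>_. 0)(x := 1)) (ends ?G h) \<noteq> 0"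
          using 1 g xuv ef by auto
        ultimately show ?thesis by blast
      next
        case 2
        obtain \<phi> where \<phi>: "drop2 \<phi> (ends G h) \<noteq> 0" "\<And>h'. h' \<in> T - {h} \<Longrightarrow> drop2 \<phi> (ends G h') = 0"
          using cut[OF 2(2)] by blast
        define \<psi> where "\<psi> = \<phi>(x := if g = e then \<phi> u else \<phi> v)"
        have "drop2 \<psi> (ends ?G g) = 0" using g ef xuv by (auto simp: \<psi>_def)
        moreover have "drop2 \<psi> (ends ?G h') = drop2 \<phi> (ends G h')" if "h' \<in> T" for h'
          unfolding \<psi>_def using that old[of h'] TE False by blast
        ultimately show ?thesis using \<phi> 2 by (metis Diff_iff insertE)
      qed
    next
      have "g \<notin> T" using g False fT by auto
      then show "card (insert g T) + 1 = card (vertices ?G)" using finT wf card series.hyps by simp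
    qed (use TE g series.hyps in auto)
    from ab(4) show ?thesis
    proof
      assume *: "\<forall>p q. b f * q\<^sup>2 \<le> a e * p\<^sup>2 + be * (p + q)\<^sup>2"
      have "certificate ?G a b (insert e T)"
      proof (rule extend)
        fix \<phi> :: "'a \<Rightarrow> real"
        show "- be * ((\<phi> u - \<phi> x) + (\<phi> x - \<phi> v))\<^sup>2 \<le>
          (if e = e then a e else - b e) * (\<phi> u - \<phi> x)\<^sup>2 + (if e = f then a f else - b f) * (\<phi> x - \<phi> v)\<^sup>2"
          using *[rule_format, of "\<phi> x - \<phi> v" "\<phi> u - \<phi> x"] ef by simp
      qed simp
      then show ?thesis ..
    next
      assume *: "\<forall>p q. b e * p\<^sup>2 \<le> a f * q\<^sup>2 + be * (p + q)\<^sup>2"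
      have "certificate ?G a b (insert f T)"
      proof (rule extend)
        fix \<phi> :: "'a \<Rightarrow> real"
        show "- be * ((\<phi> u - \<phi> x) + (\<phi> x - \<phi> v))\<^sup>2 \<le>
          (if f = e then a e else - b e) * (\<phi> u - \<phi> x)\<^sup>2 + (if f = f then a f else - b f) * (\<phi> x - \<phi> v)\<^sup>2"
          using *[rule_format, of "\<phi> u - \<phi> x" "\<phi> x - \<phi> v"] ef by simp
      qed simp
      then show ?thesis ..
    qed
  qed
qed

text \<open>
  Connectedness of the graph, in the form that determines the kernel of \<open>B\<^sup>T\<close>.
\<close>
lemma constant_on_connected:
  assumes "two_sp_graph G" "\<And>e. e \<in> edges G \<Longrightarrow> drop2 \<phi> (ends G e) = 0"
    and "p \<in> vertices G" "q \<in> vertices G"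
  shows "\<phi> p = \<phi> q"
proof -
  have "\<exists>c. \<forall>p\<in>vertices G. \<phi> p = c"
    using assms(1,2)
  proof (induction)
    case (two_cycle u v e f en)
    then have "\<phi> u = \<phi> v" using two_cycle.prems[of e] by simp
    then show ?case by simp
  next
    case (parallel G e f)
    then show ?case by (metis fun_upd_other insertCI select_convs)
  next
    case (series G e u v f x)
    have ef: "e \<noteq> f" using series.hyps by auto
    have eq: "\<phi> u = \<phi> x" "\<phi> x = \<phi> v" 
      using series.prems[of e] series.prems[of f] series.hyps ef by auto
    have "drop2 \<phi> (ends G g) = 0" if "g \<in> edges G" for g
      using series.prems[of g] series.hyps that eq by (cases "g = e") (auto split: if_splits)
    then obtain c where "\<forall>p\<in>vertices G. \<phi> p = c" using series.IH by blast
    moreover have "u \<in> vertices G" using two_sp_graph_wf(3)[OF series.hyps(1,2)] series.hyps by simp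
    ultimately show ?case using eq by simp
  qed
  then show ?thesis using assms by metis
qed


section \<open>Eigenvalues of symmetric matrices and of compressed projections\<close>

text \<open>
  A real symmetric matrix has a complex eigenvalue, which its Hermitian form shows to be real. It is
  then a root of the real characteristic polynomial. Otherwise the minimum in \<open>lambda_min\<close> would be
  taken over the empty set.
\<close>
lemma symmetric_real_eigenvalue_exists:
  fixes A :: "real mat"
  assumes A: "A \<in> carrier_mat k k" and sym: "A\<^sup>T = A" and k: "k > 0"
  shows "\<exists>x. eigenvalue A x"
proof -
  define C where "C = map_mat complex_of_real A"
  have C: "C \<in> carrier_mat k k" using A by (simp add: C_def)
  have symC: "C\<^sup>T = C" by (simp add: C_def map_mat_transpose sym)
  obtain c v where v: "v \<in> carrier_vec k" "v \<noteq> 0\<^sub>v k" "C *\<^sub>v v = c \<cdot>\<^sub>v v"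
    using spectrum_non_empty[OF C k] C
    by (auto simp: spectrum_def eigenvalue_def eigenvector_def)
  have conj: "conjugate (C *\<^sub>v v) = C *\<^sub>v conjugate v"
  proof (rule eq_vecI)
    fix i assume "i < dim_vec (C *\<^sub>v conjugate v)"
    then show "conjugate (C *\<^sub>v v) $ i = (C *\<^sub>v conjugate v) $ i"
      using A v(1) by (simp add: C_def scalar_prod_def)
  qed (use A in \<open>simp add: C_def\<close>)
  have "c * (v \<bullet>c v) = (C *\<^sub>v v) \<bullet>c v" using v by simp
  also have "\<dots> = v \<bullet> (C *\<^sub>v conjugate v)"
    using transpose_vec_mult_scalar[OF C, of "conjugate v" v] symC v C
    by (metis carrier_vec_conjugate comm_scalar_prod mult_mat_vec_carrier)
  also have "\<dots> = v \<bullet>c (c \<cdot>\<^sub>v v)" by (simp add: conj[symmetric] v)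
  also have "\<dots> = cnj c * (v \<bullet>c v)" using v by (simp add: conjugate_smult_vec)
  finally have "cnj c = c" using v by auto
  then obtain r where r: "c = complex_of_real r" by (metis Reals_cases Reals_cnj_iff)
  have "eigenvalue C c" using v C by (auto simp: eigenvalue_def eigenvector_def)
  then have "poly (char_poly C) (complex_of_real r) = 0"
    using eigenvalue_root_char_poly[OF C] r by simp
  moreover have "char_poly C = map_poly complex_of_real (char_poly A)"
    unfolding C_def by (rule of_real_hom.char_poly_hom[OF A])
  moreover have "poly (map_poly complex_of_real (char_poly A)) (complex_of_real r)
      = complex_of_real (poly (char_poly A) r)" by simp
  ultimately have "poly (char_poly A) r = 0" by (metis of_real_eq_0_iff)
  then show ?thesis using eigenvalue_root_char_poly[OF A] by blast
qed

lemma lambda_min_ge: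
  fixes A :: "real mat"
  assumes A: "A \<in> carrier_mat k k" and "A\<^sup>T = A" "k > 0"
    and "\<And>x. eigenvalue A x \<Longrightarrow> c \<le> x"
  shows "c \<le> lambda_min A"
  using symmetric_real_eigenvalue_exists[of A k] assms card_finite_spectrum(1)[OF A]
  by (simp add: lambda_min_def spectrum_def)

lemma scalar_prod_self_eq_0:
  fixes x :: "real vec"
  assumes "x \<in> carrier_vec n" "x \<bullet> x = 0"
  shows "x = 0\<^sub>v n"
  using assms conjugate_square_eq_0_vec[of x n] by simp

text \<open>
  For an eigenvector \<open>x\<close>, extended by zeros to \<open>z\<close>, both \<open>|P z|\<^sup>2 = z \<bullet> P z\<close> and the entries of \<open>P z\<close> in
  \<open>J\<close> are determined by \<open>\<mu>\<close> and \<open>x\<close>; the hypothesis \<open>dom\<close> then says \<open>\<mu> \<le> c \<mu>\<^sup>2\<close>. The hypothesis \<open>inj\<close>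
  excludes \<open>\<mu> = 0\<close>.
\<close>
lemma eigenvalue_principal_submatrix_ge:
  fixes P :: "real mat"
  assumes P: "P \<in> carrier_mat n n" "P\<^sup>T = P" "P * P = P" and J: "J \<subseteq> {..<n}" and c: "c > 0"
    and dom: "\<And>z. z \<in> carrier_vec n \<Longrightarrow> (P *\<^sub>v z) \<bullet> (P *\<^sub>v z) \<le> c * (\<Sum>j\<in>J. ((P *\<^sub>v z) $ j)\<^sup>2)"
    and inj: "\<And>z. z \<in> carrier_vec n \<Longrightarrow> (\<And>i. i < n \<Longrightarrow> i \<notin> J \<Longrightarrow> z $ i = 0) \<Longrightarrow>
               P *\<^sub>v z = 0\<^sub>v n \<Longrightarrow> z = 0\<^sub>v n"
    and ev: "eigenvalue (submatrix P J J) \<mu>"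
  shows "1 / c \<le> \<mu>"
proof -
  define k where "k = card J"
  have JJ: "{i. i < n \<and> i \<in> J} = J" using J by auto
  have finJ: "finite J" using J finite_subset by blast
  let ?A = "submatrix P J J"
  have A: "?A \<in> carrier_mat k k" "\<And>i j. i < k \<Longrightarrow> j < k \<Longrightarrow> ?A $$ (i, j) = P $$ (pick J i, pick J j)"
    using P(1) JJ by (auto simp: submatrix_def k_def)
  obtain x where x: "x \<in> carrier_vec k" "x \<noteq> 0\<^sub>v k" "?A *\<^sub>v x = \<mu> \<cdot>\<^sub>v x"
    using ev A by (auto simp: eigenvalue_def eigenvector_def)
  \<comment> \<open>The inverse of \<open>pick J\<close>, which enumerates \<open>J\<close> in increasing order.\<close>
  define rank where "rank j = card {a \<in> J. a < j}" for j
  have pick: "pick J i \<in> J" "rank (pick J i) = i" if "i < k" for i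
    using that pick_in_set_le[of i J] card_pick_le[of i J] by (auto simp: rank_def k_def)
  have rank: "pick J (rank j) = j" "rank j < k" if "j \<in> J" for j
  proof -
    show "pick J (rank j) = j" using pick_card_in_set[OF that] by (simp add: rank_def)
    have "{a \<in> J. a < j} \<subset> J" using that by auto
    then show "rank j < k" using finJ by (simp add: rank_def k_def psubset_card_mono)
  qed
  have bij: "bij_betw (pick J) {..<k} J"
    by (rule bij_betw_byWitness[where f' = rank]) (use pick rank in auto)
  define z where "z = vec n (\<lambda>j. if j \<in> J then x $ rank j else 0)"
  have z: "z \<in> carrier_vec n" "\<And>i. i < k \<Longrightarrow> z $ pick J i = x $ i" "\<And>j. j < n \<Longrightarrow> j \<notin> J \<Longrightarrow> z $ j = 0"
  proof -
    have "pick J i < n" if "i < k" for i using pick(1)[OF that] J by auto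
    then show "z $ pick J i = x $ i" if "i < k" for i using that pick by (simp add: z_def)
  qed (simp_all add: z_def)
  have sumJ: "(\<Sum>j<n. h j) = (\<Sum>i<k. h (pick J i))" if "\<And>j. j < n \<Longrightarrow> j \<notin> J \<Longrightarrow> h j = 0" for h :: "nat \<Rightarrow> real"
  proof -
    have "(\<Sum>j<n. h j) = (\<Sum>j\<in>J. h j)" using J that by (intro sum.mono_neutral_right) auto
    then show ?thesis using sum.reindex_bij_betw[OF bij, of h] by simp
  qed
  have Pz: "(P *\<^sub>v z) $ pick J i = \<mu> * x $ i" if i: "i < k" for i
  proof -
    have "(P *\<^sub>v z) $ pick J i = (\<Sum>j<n. P $$ (pick J i, j) * z $ j)"
      using pick(1)[OF i] J P z by (auto simp: scalar_prod_def atLeast0LessThan)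
    also have "\<dots> = (\<Sum>l<k. P $$ (pick J i, pick J l) * z $ (pick J l))"
      by (rule sumJ) (simp add: z)
    also have "\<dots> = (?A *\<^sub>v x) $ i"
      using A x(1) i z by (simp add: scalar_prod_def atLeast0LessThan)
    finally show ?thesis using x i by simp
  qed
  define s where "s = (\<Sum>i<k. (x $ i)\<^sup>2)"
  have "x \<bullet> x \<noteq> 0" using scalar_prod_self_eq_0[OF x(1)] x(2) by blast
  then have s: "s > 0"
    using x by (simp add: s_def scalar_prod_def atLeast0LessThan power2_eq_square[symmetric]
        sum_nonneg less_le)
  have Pzc: "P *\<^sub>v z \<in> carrier_vec n" using P z by simp
  have "(P *\<^sub>v z) \<bullet> (P *\<^sub>v z) = z \<bullet> (P *\<^sub>v (P *\<^sub>v z))"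
    using transpose_vec_mult_scalar[OF P(1) Pzc z(1)] P comm_scalar_prod[OF Pzc Pzc]
    by (metis Pzc transpose_vec_mult_scalar z(1))
  also have "P *\<^sub>v (P *\<^sub>v z) = P *\<^sub>v z" using P z by (metis assoc_mult_mat_vec)
  also have "z \<bullet> (P *\<^sub>v z) = (\<Sum>j<n. z $ j * (P *\<^sub>v z) $ j)"
    using Pzc P by (simp add: scalar_prod_def atLeast0LessThan)
  also have "\<dots> = (\<Sum>i<k. z $ pick J i * (P *\<^sub>v z) $ pick J i)"
    by (rule sumJ) (simp add: z)
  also have "\<dots> = \<mu> * s"
    using z Pz by (simp add: s_def sum_distrib_left power2_eq_square mult_ac)
  finally have norm: "(P *\<^sub>v z) \<bullet> (P *\<^sub>v z) = \<mu> * s" .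
  have "\<mu> \<noteq> 0"
  proof
    assume "\<mu> = 0"
    then have "P *\<^sub>v z = 0\<^sub>v n" using scalar_prod_self_eq_0[OF Pzc] norm by simp
    then have "z = 0\<^sub>v n" using inj z by blast
    then have "x $ i = 0" if "i < k" for i using z(2)[OF that] pick(1)[OF that] J by auto
    then show False using x by auto
  qed
  moreover have "0 \<le> \<mu> * s" unfolding norm[symmetric]
    by (simp add: scalar_prod_def sum_nonneg)
  ultimately have pos: "\<mu> > 0" using s by (simp add: zero_le_mult_iff)
  have "(\<Sum>j\<in>J. ((P *\<^sub>v z) $ j)\<^sup>2) = (\<Sum>i<k. ((P *\<^sub>v z) $ pick J i)\<^sup>2)"
    by (rule sum.reindex_bij_betw[OF bij, symmetric])
  also have "\<dots> = \<mu>\<^sup>2 * s" using Pz by (simp add: s_def sum_distrib_left power_mult_distrib)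
  finally have "\<mu> * s \<le> c * (\<mu>\<^sup>2 * s)" using dom[OF z(1)] norm by simp
  then have "1 \<le> c * \<mu>" using s pos by (simp add: power2_eq_square)
  then show ?thesis using c by (simp add: field_simps)
qed

section \<open>The projection given by the pseudoinverse\<close>

lemma scalar_prod_gram:
  fixes M :: "real mat"
  assumes M: "M \<in> carrier_mat n m" and v: "v \<in> carrier_vec m"
  shows "v \<bullet> ((M\<^sup>T * M) *\<^sub>v v) = (M *\<^sub>v v) \<bullet> (M *\<^sub>v v)"
proof -
  have Mv: "M *\<^sub>v v \<in> carrier_vec n" using M v by simp
  have "(M\<^sup>T * M) *\<^sub>v v = M\<^sup>T *\<^sub>v (M *\<^sub>v v)" using M v by simp
  then show ?thesis
    using transpose_vec_mult_scalar[OF M v Mv] M v Mv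
    by (metis comm_scalar_prod mult_mat_vec_carrier transpose_carrier_mat)
qed

text \<open>
  When the kernel of \<open>M\<close> consists of the constant vectors, the pseudoinverse of \<open>A = M\<^sup>T M\<close> is explicit:
  if \<open>J\<close> denotes the projection onto the constants, then \<open>A + J\<close> is invertible and the pseudoinverse is
  \<open>(A + J)\<^sup>-\<^sup>1 - J\<close>. This shows that the description defining \<open>pinv\<close> is satisfied, and the identity
  \<open>X A = 1 - J\<close> gives the properties of the projection onto the column space of \<open>M\<close>.
\<close>
lemma projection_via_pinv:
  fixes M :: "real mat"
  assumes M: "M \<in> carrier_mat n m" and m: "m > 0"
    and ones: "M *\<^sub>v vec m (\<lambda>_. 1) = 0\<^sub>v n"
    and ker: "\<And>v i j. v \<in> carrier_vec m \<Longrightarrow> M *\<^sub>v v = 0\<^sub>v n \<Longrightarrow> i < m \<Longrightarrow> j < m \<Longrightarrow> v $ i = v $ j"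
  defines "X \<equiv> pinv (M\<^sup>T * M)"
  defines "P \<equiv> M * X * M\<^sup>T"
  shows "X \<in> carrier_mat m m" "P\<^sup>T = P" "P * P = P" "P * M = M"
proof -
  define A where "A = M\<^sup>T * M"
  define J where "J = mat m m (\<lambda>_. 1 / real m)"
  have A: "A \<in> carrier_mat m m" using M by (simp add: A_def)
  have J: "J \<in> carrier_mat m m" by (simp add: J_def)
  have symA: "A\<^sup>T = A" using M by (simp add: A_def transpose_mult[of _ m n])
  have symJ: "J\<^sup>T = J" by (auto simp: J_def)
  have JJ: "J * J = J" using m by (auto simp: J_def scalar_prod_def)
  have MJ: "M * J = 0\<^sub>m n m"
  proof (rule eq_matI)
    fix i j assume ij: "i < dim_row (0\<^sub>m n m :: real mat)" "j < dim_col (0\<^sub>m n m :: real mat)"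
    have "(M *\<^sub>v vec m (\<lambda>_. 1)) $ i = (\<Sum>l<m. M $$ (i, l))"
      using M ij by (simp add: scalar_prod_def atLeast0LessThan)
    then have "(\<Sum>l<m. M $$ (i, l)) = 0" using ones ij by simp
    moreover have "(M * J) $$ (i, j) = (\<Sum>l<m. M $$ (i, l)) / real m"
      using M ij by (simp add: J_def scalar_prod_def atLeast0LessThan sum_divide_distrib)
    ultimately show "(M * J) $$ (i, j) = 0\<^sub>m n m $$ (i, j)" using ij by simp
  qed (use M J in auto)
  have AJ: "A * J = 0\<^sub>m m m" using M J MJ by (simp add: A_def assoc_mult_mat[of _ m n _ m _ m])
  have JA: "J * A = 0\<^sub>m m m"
    using transpose_mult[OF A J] AJ symA symJ by simp
  define K where "K = A + J"
  have K: "K \<in> carrier_mat m m" using A J by (simp add: K_def)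
  have "det K \<noteq> 0"
  proof
    assume "det K = 0"
    then obtain v where v: "v \<in> carrier_vec m" "v \<noteq> 0\<^sub>v m" "K *\<^sub>v v = 0\<^sub>v m"
      using det_0_iff_vec_prod_zero_field[OF K] by blast
    define s where "s = (\<Sum>i<m. v $ i)"
    have Jv: "v \<bullet> (J *\<^sub>v v) = s\<^sup>2 / real m"
    proof -
      have "(J *\<^sub>v v) $ i = s / real m" if "i < m" for i
        using v that by (simp add: J_def scalar_prod_def atLeast0LessThan s_def sum_divide_distrib)
      then have "v \<bullet> (J *\<^sub>v v) = (\<Sum>i<m. v $ i * (s / real m))"
        using J by (simp add: scalar_prod_def atLeast0LessThan)
      also have "\<dots> = s * (s / real m)" unfolding s_def by (rule sum_distrib_right[symmetric])
      finally show ?thesis by (simp add: power2_eq_square)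
    qed
    have "0 = v \<bullet> (K *\<^sub>v v)" using v by simp
    also have "\<dots> = v \<bullet> (A *\<^sub>v v) + v \<bullet> (J *\<^sub>v v)"
      using add_mult_distrib_mat_vec[OF A J v(1)] A J v(1)
        scalar_prod_add_distrib[of v m "A *\<^sub>v v" "J *\<^sub>v v"] by (simp add: K_def)
    also have "v \<bullet> (A *\<^sub>v v) = (M *\<^sub>v v) \<bullet> (M *\<^sub>v v)"
      unfolding A_def by (rule scalar_prod_gram[OF M v(1)])
    finally have eq: "(M *\<^sub>v v) \<bullet> (M *\<^sub>v v) + s\<^sup>2 / real m = 0" using Jv by simp
    have "0 \<le> (M *\<^sub>v v) \<bullet> (M *\<^sub>v v)" by (simp add: scalar_prod_def sum_nonneg)
    moreover have "0 \<le> s\<^sup>2 / real m" by simp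
    ultimately have "(M *\<^sub>v v) \<bullet> (M *\<^sub>v v) = 0" "s\<^sup>2 / real m = 0" using eq by linarith+
    then have s0: "s = 0" using m by simp
    have "M *\<^sub>v v \<in> carrier_vec n" using M v by simp
    then have "M *\<^sub>v v = 0\<^sub>v n"
      using \<open>(M *\<^sub>v v) \<bullet> (M *\<^sub>v v) = 0\<close> by (rule scalar_prod_self_eq_0)
    then have const: "v $ i = v $ 0" if "i < m" for i using ker[OF v(1)] m that by blast
    have "s = (\<Sum>i<m. v $ 0)" unfolding s_def by (intro sum.cong refl const) simp
    then have "v $ 0 = 0" using s0 m by simp
    then have "v $ i = 0" if "i < m" for i using const[OF that] by metis
    then have "v = 0\<^sub>v m" using v(1) by (intro eq_vecI) simp_all
    then show False using v(2) by blast
  qed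
  then obtain L where L: "L \<in> carrier_mat m m" "L * K = 1\<^sub>m m" "K * L = 1\<^sub>m m"
    using det_non_zero_imp_unit[OF K, of "()"]
    by (auto simp: Units_def ring_mat_def)
  have KJ: "K * J = J" "J * K = J"
    using A J AJ JA JJ by (simp_all add: K_def add_mult_distrib_mat mult_add_distrib_mat[of _ m m])
  have LJ: "L * J = J"
    using assoc_mult_mat[OF L(1) K J] L(2) KJ(1) left_mult_one_mat[OF J] by simp
  have JL: "J * L = J"
    using assoc_mult_mat[OF J K L(1)] L(3) KJ(2) right_mult_one_mat[OF J] by simp
  have symK: "K\<^sup>T = K" using A J symA symJ by (simp add: K_def transpose_add)
  have "L\<^sup>T * K = 1\<^sub>m m" using transpose_mult[OF K L(1)] L symK by simp
  then have symL: "L\<^sup>T = L"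
    using assoc_mult_mat[of "L\<^sup>T" m m K m L m] L K by simp
  define Y where "Y = L - J"
  have Y: "Y \<in> carrier_mat m m" using L J by (simp add: Y_def minus_carrier_mat)
  have A_eq: "A = K - J" using A J by (auto simp: K_def)
  have D: "1\<^sub>m m - J \<in> carrier_mat m m" using J by (simp add: minus_carrier_mat)
  have m0: "B - 0\<^sub>m m m = B" if "B \<in> carrier_mat m m" for B :: "real mat" using that by auto
  have "A * L = 1\<^sub>m m - J"
    unfolding A_eq using minus_mult_distrib_mat[OF K J L(1)] L JL by simp
  then have AY: "A * Y = 1\<^sub>m m - J"
    unfolding Y_def using mult_minus_distrib_mat[OF A L(1) J] AJ m0[OF D] by simp
  have "L * A = 1\<^sub>m m - J"
    unfolding A_eq using mult_minus_distrib_mat[OF L(1) K J] L LJ by simp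
  then have YA: "Y * A = 1\<^sub>m m - J"
    unfolding Y_def using minus_mult_distrib_mat[OF L(1) J A] JA m0[OF D] by simp
  have YJ: "Y * J = 0\<^sub>m m m"
    unfolding Y_def using minus_mult_distrib_mat[OF L(1) J J] LJ JJ J by auto
  have symD: "(1\<^sub>m m - J)\<^sup>T = 1\<^sub>m m - J" using transpose_minus[OF one_carrier_mat J] symJ by simp
  have "is_pinv A Y"
    unfolding is_pinv_def
  proof (intro conjI)
    show "Y \<in> carrier_mat (dim_col A) (dim_row A)" using A Y by simp
    show "A * Y * A = A"
      unfolding AY using minus_mult_distrib_mat[OF one_carrier_mat J A] JA m0[OF A] A by simp
    show "Y * A * Y = Y"
      using assoc_mult_mat[OF Y A Y] AY mult_minus_distrib_mat[OF Y one_carrier_mat J] YJ m0[OF Y] Y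
      by simp
  qed (simp_all add: AY YA symD)
  then have "X = Y"
    unfolding X_def pinv_def A_def[symmetric] by (intro the_equality is_pinv_unique)
  then show X: "X \<in> carrier_mat m m" using Y by simp
  have symX: "X\<^sup>T = X" using \<open>X = Y\<close> L J symL symJ by (simp add: Y_def transpose_minus)
  have MX: "M * X \<in> carrier_mat n m" using M X by simp
  have P: "P \<in> carrier_mat n n" using M X by (simp add: P_def)
  have "P\<^sup>T = M * (M * X)\<^sup>T"
    unfolding P_def using transpose_mult[OF MX, of "M\<^sup>T" n] M by simp
  also have "\<dots> = M * (X * M\<^sup>T)" using transpose_mult[OF M X] symX by simp
  also have "\<dots> = P" unfolding P_def using M X by (simp add: assoc_mult_mat[of _ n m _ m _ n])
  finally show "P\<^sup>T = P" .
  have "P * M = M * X * (M\<^sup>T * M)" unfolding P_def using MX M by (simp add: assoc_mult_mat[of _ n m _ n _ m])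
  also have "\<dots> = M * (X * A)" using M X A by (simp add: assoc_mult_mat[of _ n m _ m _ m] A_def)
  also have "\<dots> = M"
    using YA \<open>X = Y\<close> mult_minus_distrib_mat[OF M one_carrier_mat J] MJ M by auto
  finally show PM: "P * M = M" .
  have "P * P = P * (M * (X * M\<^sup>T))" unfolding P_def using M X by (simp add: assoc_mult_mat[of _ n m _ m _ n])
  also have "\<dots> = P * M * (X * M\<^sup>T)" using P M X by (simp add: assoc_mult_mat[of _ n n _ m _ n])
  also have "\<dots> = P" unfolding PM unfolding P_def using M X by (simp add: assoc_mult_mat[of _ n m _ m _ n])
  finally show "P * P = P" .
qed


section \<open>The bound for series-parallel graphs\<close>

text \<open>
  With \<open>a = (n - 1) w\<close> and \<open>b = w\<close> the form in the certificate is \<open>n\<close> times the energy on \<open>T\<close> minus the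
  total energy.
\<close>
lemma dominating_tree_exists:
  assumes G: "two_sp_graph G" and w: "\<And>e. e \<in> edges G \<Longrightarrow> w e > 0"
  obtains T where "T \<subseteq> edges G" "card T + 1 = card (vertices G)"
    "\<forall>e\<in>T. \<exists>\<phi>. drop2 \<phi> (ends G e) \<noteq> 0 \<and> (\<forall>f\<in>T - {e}. drop2 \<phi> (ends G f) = 0)"
    "\<forall>\<phi>. (\<Sum>e\<in>edges G. w e * drop2 \<phi> (ends G e))
        \<le> real (card (edges G)) * (\<Sum>e\<in>T. w e * drop2 \<phi> (ends G e))"
proof -
  let ?n = "real (card (edges G))"
  obtain T where T: "certificate G (\<lambda>e. (?n - 1) * w e) w T"
    using certificate_exists[OF G, of "\<lambda>_. 1" w "\<lambda>e. (?n - 1) * w e"] w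
    by (auto simp: algebra_simps)
  have fin: "finite (edges G)" using two_sp_graph_wf[OF G] by blast
  have TE: "T \<subseteq> edges G" using T by (simp add: certificate_def)
  have "(\<Sum>e\<in>edges G. w e * drop2 \<phi> (ends G e)) \<le> ?n * (\<Sum>e\<in>T. w e * drop2 \<phi> (ends G e))" for \<phi>
  proof -
    let ?d = "\<lambda>e. drop2 \<phi> (ends G e)"
    have "0 \<le> (\<Sum>e\<in>edges G. (if e \<in> T then (?n - 1) * w e else - w e) * ?d e)"
      using T by (simp add: certificate_def)
    also have "\<dots> = (\<Sum>e\<in>edges G. (if e \<in> T then ?n * (w e * ?d e) else 0) - w e * ?d e)"
      by (intro sum.cong) (auto simp: algebra_simps)
    also have "\<dots> = ?n * (\<Sum>e\<in>T. w e * ?d e) - (\<Sum>e\<in>edges G. w e * ?d e)"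
      using fin TE by (simp add: sum_subtractf sum.inter_restrict[symmetric] Int_absorb1 sum_distrib_left)
    finally show ?thesis by simp
  qed
  then show thesis using that[of T] T unfolding certificate_def by blast
qed

theorem mainTheorem3:
  fixes G :: "('v, 'e) multigraph" and n k :: nat
    and vs :: "'v list" and es :: "'e list"
    and src tgt :: "'e \<Rightarrow> 'v" and w :: "'e \<Rightarrow> real"
  assumes "two_sp_graph G"
    and "card (edges G) = n" and "card (vertices G) = k + 1"
    and "distinct vs" "set vs = vertices G"
    and "distinct es" "set es = edges G"
    and "orientation G src tgt"
    and "\<And>e. e \<in> edges G \<Longrightarrow> w e > 0"
  shows "(MAX I\<in>{I. I \<subseteq> edges G \<and> card I = k}.
            lambda_min (principal_submat es (proj_mat vs es src tgt w) I)) \<ge> 1 / real n"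
proof -
  note wf = two_sp_graph_wf[OF assms(1)]
  have lenv: "length vs = k + 1" using assms(3-5) distinct_card by metis
  have lene: "length es = n" using assms(2,6,7) distinct_card by metis
  have n2: "n \<ge> 2" using two_sp_graph_two_edges[OF assms(1)] assms(2) by simp
  have esE: "es ! j \<in> edges G" if "j < n" for j using that lene assms(7) nth_mem by blast
  have wpos: "w (es ! j) > 0" if "j < n" for j using assms(9) esE that by blast
  have ends: "ends G (es ! j) = {src (es ! j), tgt (es ! j)}" "src (es ! j) \<noteq> tgt (es ! j)"
    "src (es ! j) \<in> vertices G" "tgt (es ! j) \<in> vertices G" if "j < n" for j
  proof -
    show *: "ends G (es ! j) = {src (es ! j), tgt (es ! j)}"
      using assms(8) esE[OF that] by (auto simp: orientation_def)
    from wf(3)[OF esE[OF that]] show "src (es ! j) \<noteq> tgt (es ! j)"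
      "src (es ! j) \<in> vertices G" "tgt (es ! j) \<in> vertices G"
      unfolding * by (auto simp: card_insert_if split: if_splits)
  qed
  have bije: "bij_betw ((!) es) {..<n} (edges G)"
    using bij_betw_nth[OF assms(6), of "{..<n}" "edges G"] lene assms(7) by simp
  have bijv: "bij_betw ((!) vs) {..<k + 1} (vertices G)"
    using bij_betw_nth[OF assms(4), of "{..<k+1}" "vertices G"] lenv assms(5) by simp

  define B where "B = incidence_mat vs es src tgt"
  define R where "R = weight_mat es (\<lambda>e. sqrt (w e))"
  define M where "M = R * B\<^sup>T"
  have B: "B \<in> carrier_mat (k + 1) n" by (simp add: B_def incidence_mat_def lenv lene)
  have R: "R \<in> carrier_mat n n" by (simp add: R_def weight_mat_def lene)
  have M: "M \<in> carrier_mat n (k + 1)" using B R by (simp add: M_def)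
  have symR: "R\<^sup>T = R" by (auto simp: R_def weight_mat_def mat_diag_def)
  have MT: "M\<^sup>T = B * R" using transpose_mult[OF R, of "B\<^sup>T"] B symR by (simp add: M_def)
  have "w (es ! i) \<ge> 0" if "i < n" for i using wpos[OF that] by simp
  then have RR: "R * R = weight_mat es w"
    unfolding R_def weight_mat_def mat_diag_diag by (auto simp: mat_diag_def lene)
  have gram: "M\<^sup>T * M = B * weight_mat es w * B\<^sup>T"
  proof -
    have "M\<^sup>T * M = B * (R * (R * B\<^sup>T))"
      unfolding MT unfolding M_def using B R by (simp add: assoc_mult_mat[of _ "k + 1" n _ n _ "k + 1"])
    also have "R * (R * B\<^sup>T) = R * R * B\<^sup>T"
      using B R by (simp add: assoc_mult_mat[of _ n n _ n _ "k + 1"])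
    also have "B * (R * R * B\<^sup>T) = B * (R * R) * B\<^sup>T"
      using B R by (simp add: assoc_mult_mat[of _ "k + 1" n _ n _ "k + 1"])
    finally show ?thesis by (simp add: RR)
  qed

  \<comment> \<open>Potentials as coordinate vectors, in the order of the vertices that \<open>vs\<close> prescribes.\<close>
  define pot where "pot \<phi> = vec (k + 1) (\<lambda>i. \<phi> (vs ! i))" for \<phi> :: "'v \<Rightarrow> real"
  have potc: "pot \<phi> \<in> carrier_vec (k + 1)" for \<phi> by (simp add: pot_def)
  have pot_surj: "\<exists>\<phi>. v = pot \<phi>" if "v \<in> carrier_vec (k + 1)" for v
  proof
    show "v = pot (\<lambda>p. v $ the_inv_into {..<k + 1} ((!) vs) p)"
      using that bijv by (auto simp: pot_def bij_betw_def the_inv_into_f_f)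
  qed
  have Mpot: "(M *\<^sub>v pot \<phi>) $ j = sqrt (w (es ! j)) * (\<phi> (tgt (es ! j)) - \<phi> (src (es ! j)))"
    if j: "j < n" for \<phi> j
  proof -
    let ?s = "src (es ! j)" and ?t = "tgt (es ! j)"
    have "(M *\<^sub>v pot \<phi>) $ j = (R *\<^sub>v (B\<^sup>T *\<^sub>v pot \<phi>)) $ j"
      using B R potc by (simp add: M_def)
    also have "\<dots> = sqrt (w (es ! j)) * (B\<^sup>T *\<^sub>v pot \<phi>) $ j"
    proof -
      have "(R *\<^sub>v u) $ j = sqrt (w (es ! j)) * u $ j" if "u \<in> carrier_vec n" for u
      proof -
        have "(R *\<^sub>v u) $ j = (\<Sum>i<n. (if j = i then sqrt (w (es ! i)) else 0) * u $ i)"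
          using j that lene
          by (simp add: R_def weight_mat_def mat_diag_def scalar_prod_def atLeast0LessThan)
        also have "\<dots> = (\<Sum>i<n. if i = j then sqrt (w (es ! j)) * u $ j else 0)"
          by (intro sum.cong) auto
        finally show ?thesis using j by simp
      qed
      then show ?thesis using B potc by simp
    qed
    also have "(B\<^sup>T *\<^sub>v pot \<phi>) $ j = (\<Sum>i<k + 1. (if vs ! i = ?t then 1
               else if vs ! i = ?s then - 1 else 0) * \<phi> (vs ! i))"
      using j lenv lene
      by (simp add: B_def incidence_mat_def pot_def scalar_prod_def atLeast0LessThan)
    also have "\<dots> = (\<Sum>p\<in>vertices G. (if p = ?t then 1 else if p = ?s then - 1 else 0) * \<phi> p)"
      by (rule sum.reindex_bij_betw[OF bijv])
    also have "\<dots> = (\<Sum>p\<in>vertices G. (if p = ?t then \<phi> p else 0) - (if p = ?s then \<phi> p else 0))"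
      using ends[OF j] by (intro sum.cong) auto
    also have "\<dots> = \<phi> ?t - \<phi> ?s" using ends[OF j] wf by (simp add: sum_subtractf)
    finally show ?thesis .
  qed
  have Mpot2: "((M *\<^sub>v pot \<phi>) $ j)\<^sup>2 = w (es ! j) * drop2 \<phi> (ends G (es ! j))" if "j < n" for \<phi> j
    using wpos[OF that] by (simp add: Mpot that ends power_mult_distrib power2_commute)

  define X where "X = pinv (M\<^sup>T * M)"
  define P where "P = M * X * M\<^sup>T"
  have proj: "X \<in> carrier_mat (k + 1) (k + 1)" "P\<^sup>T = P" "P * P = P" "P * M = M"
  proof -
    have "vec (k + 1) (\<lambda>_. 1) = pot (\<lambda>_. 1)" by (simp add: pot_def)
    then have ones: "M *\<^sub>v vec (k + 1) (\<lambda>_. 1) = 0\<^sub>v n"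
      using Mpot[of _ "\<lambda>_. 1"] M by (intro eq_vecI) simp_all
    have ker: "v $ i = v $ j"
      if v: "v \<in> carrier_vec (k + 1)" "M *\<^sub>v v = 0\<^sub>v n" and ij: "i < k + 1" "j < k + 1" for v i j
    proof -
      obtain \<phi> where \<phi>: "v = pot \<phi>" using pot_surj v by blast
      have "drop2 \<phi> (ends G e) = 0" if e: "e \<in> edges G" for e
      proof -
        obtain l where l: "l < n" "e = es ! l" using e assms(7) lene by (metis in_set_conv_nth)
        have "(M *\<^sub>v pot \<phi>) $ l = 0" using v(2) l(1) unfolding \<phi> by simp
        then show ?thesis using Mpot2[OF l(1), of \<phi>] wpos[OF l(1)] l(2) by simp
      qed
      then have "\<phi> (vs ! i) = \<phi> (vs ! j)"
        using constant_on_connected[OF assms(1)] ij lenv assms(5) nth_mem by metis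
      then show ?thesis using ij \<phi> by (simp add: pot_def)
    qed
    show "X \<in> carrier_mat (k + 1) (k + 1)" "P\<^sup>T = P" "P * P = P" "P * M = M"
      unfolding P_def X_def
      by (rule projection_via_pinv[OF M _ ones], simp, erule (3) ker)+
  qed
  have P: "P \<in> carrier_mat n n" using M proj(1) by (simp add: P_def)
  have P_eq: "proj_mat vs es src tgt w = P"
  proof -
    have MX: "M * X \<in> carrier_mat n (k + 1)" using M proj(1) by simp
    have "proj_mat vs es src tgt w = M * X * B * R"
      unfolding proj_mat_def Let_def X_def gram unfolding M_def B_def R_def by (rule refl)
    also have "\<dots> = P"
      unfolding P_def MT by (rule assoc_mult_mat[OF MX B R])
    finally show ?thesis .
  qed

  obtain T where T: "T \<subseteq> edges G" "card T + 1 = card (vertices G)"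
    and cuts: "\<forall>e\<in>T. \<exists>\<phi>. drop2 \<phi> (ends G e) \<noteq> 0 \<and> (\<forall>f\<in>T - {e}. drop2 \<phi> (ends G f) = 0)"
    and dom: "\<forall>\<phi>. (\<Sum>e\<in>edges G. w e * drop2 \<phi> (ends G e)) \<le> real n * (\<Sum>e\<in>T. w e * drop2 \<phi> (ends G e))"
    by (rule dominating_tree_exists[OF assms(1,9), unfolded assms(2)]) blast
  have cardT: "card T = k" using T assms(3) by simp
  define J where "J = {i. i < length es \<and> es ! i \<in> T}"
  have bijT: "bij_betw ((!) es) J T"
  proof (rule bij_betw_subset[OF bije])
    show "(!) es ` J = T" using T(1) assms(7) by (force simp: J_def in_set_conv_nth)
  qed (auto simp: J_def lene)
  have Jn: "J \<subseteq> {..<n}" by (auto simp: J_def lene)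
  have cardJ: "card J = k" using bij_betw_same_card[OF bijT] cardT by simp
  have JJ: "{i. i < n \<and> i \<in> J} = J" using Jn by auto
  let ?A = "submatrix P J J"
  have A: "?A \<in> carrier_mat k k" using P JJ cardJ by (simp add: submatrix_def)
  have symA: "?A\<^sup>T = ?A"
  proof (rule eq_matI)
    fix i j assume "i < dim_row ?A" "j < dim_col ?A"
    then have ij: "i < k" "j < k" using A by auto
    have "pick J i < n" "pick J j < n" using ij pick_in_set_le[of _ J] cardJ Jn by auto
    then have "P\<^sup>T $$ (pick J i, pick J j) = P $$ (pick J j, pick J i)" using P by simp
    then show "?A\<^sup>T $$ (i, j) = ?A $$ (i, j)"
      using ij P JJ cardJ proj(2) by (simp add: submatrix_def)
  qed (use A in auto)
  have k: "k > 0"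
  proof -
    have e: "es ! 0 \<in> edges G" using esE[of 0] n2 by simp
    then have "card (ends G (es ! 0)) \<le> card (vertices G)" using wf(1,3) card_mono by metis
    then show ?thesis using wf(3)[OF e] assms(3) by linarith
  qed
  have eig: "1 / real n \<le> x" if "eigenvalue ?A x" for x
  proof (rule eigenvalue_principal_submatrix_ge[OF P proj(2,3) Jn _ _ _ that])
    show "real n > 0" using n2 by simp
  next
    fix z :: "real vec"
    assume z: "z \<in> carrier_vec n"
    have "P *\<^sub>v z = M *\<^sub>v (X *\<^sub>v (M\<^sup>T *\<^sub>v z))"
      using M proj(1) z by (simp add: P_def assoc_mult_mat_vec[of _ n "k+1" _ n])
    moreover have "X *\<^sub>v (M\<^sup>T *\<^sub>v z) \<in> carrier_vec (k + 1)" using M proj(1) z by simp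
    ultimately obtain \<phi> where Pz: "P *\<^sub>v z = M *\<^sub>v pot \<phi>" using pot_surj by metis
    have "(P *\<^sub>v z) \<bullet> (P *\<^sub>v z) = (\<Sum>j<n. ((M *\<^sub>v pot \<phi>) $ j)\<^sup>2)"
      using M by (simp add: Pz scalar_prod_def atLeast0LessThan power2_eq_square)
    also have "\<dots> = (\<Sum>j<n. w (es ! j) * drop2 \<phi> (ends G (es ! j)))"
      by (intro sum.cong) (simp_all add: Mpot2)
    also have "\<dots> = (\<Sum>e\<in>edges G. w e * drop2 \<phi> (ends G e))"
      by (rule sum.reindex_bij_betw[OF bije])
    also have "\<dots> \<le> real n * (\<Sum>e\<in>T. w e * drop2 \<phi> (ends G e))" using dom by blast
    also have "(\<Sum>e\<in>T. w e * drop2 \<phi> (ends G e)) = (\<Sum>j\<in>J. w (es ! j) * drop2 \<phi> (ends G (es ! j)))"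
      by (rule sum.reindex_bij_betw[OF bijT, symmetric])
    also have "\<dots> = (\<Sum>j\<in>J. ((P *\<^sub>v z) $ j)\<^sup>2)"
      using Jn by (intro sum.cong) (auto simp: Pz Mpot2)
    finally show "(P *\<^sub>v z) \<bullet> (P *\<^sub>v z) \<le> real n * (\<Sum>j\<in>J. ((P *\<^sub>v z) $ j)\<^sup>2)" .
  next
    fix z :: "real vec"
    assume z: "z \<in> carrier_vec n" and supp: "\<And>i. i < n \<Longrightarrow> i \<notin> J \<Longrightarrow> z $ i = 0"
      and Pz: "P *\<^sub>v z = 0\<^sub>v n"
    \<comment> \<open>\<open>z\<close> is orthogonal to the range of \<open>M\<close>, and the cut at \<open>es ! j\<close> isolates its entry \<open>z $ j\<close>.\<close>
    have orth: "(\<Sum>i<n. z $ i * (M *\<^sub>v pot \<phi>) $ i) = 0" for \<phi>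
    proof -
      let ?y = "M *\<^sub>v pot \<phi>"
      have y: "?y \<in> carrier_vec n" using M potc by simp
      have "P *\<^sub>v ?y = ?y" using proj(4) P M potc by (metis assoc_mult_mat_vec)
      moreover have "(P *\<^sub>v z) \<bullet> ?y = z \<bullet> (P *\<^sub>v ?y)"
        using transpose_vec_mult_scalar[OF P z y] transpose_vec_mult_scalar[OF P y z] proj(2) P y z
        by (metis comm_scalar_prod mult_mat_vec_carrier)
      ultimately have "z \<bullet> ?y = 0" using Pz y by simp
      then show ?thesis using y M by (simp add: scalar_prod_def atLeast0LessThan)
    qed
    have "z $ j = 0" if j: "j \<in> J" for j
    proof -
      have jn: "j < n" using j Jn by auto
      obtain \<phi> where \<phi>: "drop2 \<phi> (ends G (es ! j)) \<noteq> 0"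
        "\<And>f. f \<in> T - {es ! j} \<Longrightarrow> drop2 \<phi> (ends G f) = 0"
        using cuts[rule_format, of "es ! j"] j unfolding J_def by blast
      have zero: "z $ i * (M *\<^sub>v pot \<phi>) $ i = 0" if i: "i < n" "i \<noteq> j" for i
      proof (cases "i \<in> J")
        case True
        then have "es ! i \<in> T - {es ! j}"
          using i jn assms(6) lene by (auto simp: J_def nth_eq_iff_index_eq)
        then show ?thesis using Mpot2[OF i(1), of \<phi>] \<phi>(2) by simp
      qed (use supp i in simp)
      have "(\<Sum>i\<in>{..<n} - {j}. z $ i * (M *\<^sub>v pot \<phi>) $ i) = 0"
        by (intro sum.neutral ballI zero) auto
      then have "(\<Sum>i<n. z $ i * (M *\<^sub>v pot \<phi>) $ i) = z $ j * (M *\<^sub>v pot \<phi>) $ j"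
        using jn by (simp add: sum.remove[of _ j])
      moreover have "(M *\<^sub>v pot \<phi>) $ j \<noteq> 0" using Mpot2[OF jn, of \<phi>] \<phi>(1) wpos[OF jn] by auto
      ultimately show ?thesis using orth[of \<phi>] by simp
    qed
    then show "z = 0\<^sub>v n" using z supp by (intro eq_vecI) auto
  qed
  have "1 / real n \<le> lambda_min (principal_submat es P T)"
    using lambda_min_ge[OF A symA k eig] by (simp add: principal_submat_def Let_def J_def)
  also have "\<dots> \<le> (MAX I\<in>{I. I \<subseteq> edges G \<and> card I = k}. lambda_min (principal_submat es P I))"
    using T(1) cardT wf(2) by (intro Max_ge) auto
  finally show ?thesis by (simp add: P_eq)
qed

end
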